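(* Let $\boldsymbol{Y}\in\mathbb{C}^{M\times L}$ be an observation matrix with sample covariance matrix $\boldsymbol{R}=\frac1L\boldsymbol{Y}\boldsymbol{Y}^*$, whose eigenvalues $\lambda_1,\dots,\lambda_M$ lie in a compact interval of the positive real axis. The high-dimensional decision statistic $\hat\eta$ associated with the square function $g(z)=z^2$ (the high-dimensional Frobenius norm test) has the form $$\hat\eta = T_{HDS}=\frac1M\operatorname{tr}(\boldsymbol{R}^2)+\frac1{LM}\big(\operatorname{tr}(\boldsymbol{R})\big)^2=\frac1M\sum_{i=1}^M\lambda_i^2+\frac1{LM}\Big(\sum_{i=1}^M\lambda_i\Big)^2=\frac1M\Big(1+\frac1L\Big)\sum_{i=1}^M\lambda_i^2+\frac{2}{LM}\sum_{1\le i<k\le M}\lambda_i\lambda_k .$$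
   Context: For a complex function $g$, analytic on the positive real axis, the high-dimensional decision statistic associated with the linear spectral statistic $\frac1M\sum_{i=1}^M g(\lambda_i)$ is $$\hat\eta=\Big(1-\frac LM\Big)\frac{1}{2\pi j}\oint_{\mathcal C}\frac{g(z)}{z}\,dz+\frac LM\cdot\frac{1}{2\pi j}\oint_{\mathcal C}\frac{\phi_M(\omega)}{\omega}\,\psi_M(\omega)\,d\omega,$$ where $j=\sqrt{-1}$, $$z_M(\omega)=\omega\Big(1-\frac1L\sum_{i=1}^M\frac{\lambda_i}{\lambda_i-\omega}\Big),\qquad \phi_M(\omega)=g(z_M(\omega)),\qquad \psi_M(\omega)=\frac{dz_M(\omega)}{d\omega}=1-\frac1L\sum_{i=1}^M\frac{\lambda_i^2}{(\lambda_i-\omega)^2},$$ and $\mathcal C$ is a positively oriented simple closed contour enclosing all the eigenvalues $\lambda_1,\dots,\lambda_M$ of $\boldsymbol{R}$. Here $M$ is the number of antennas and $L$ the number of samples. *)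

theory Defs
  imports "HOL-Complex_Analysis.Complex_Analysis" "Jordan_Normal_Form.Schur_Decomposition"
begin

definition mat_trace :: "'a :: comm_monoid_add mat \<Rightarrow> 'a" where
  "mat_trace A = (\<Sum>i<dim_row A. A $$ (i, i))"

definition sample_covariance :: "complex mat \<Rightarrow> complex mat" where
  "sample_covariance Y = (1 / of_nat (dim_col Y)) \<cdot>\<^sub>m (Y * mat_adjoint Y)"

text \<open>The numbers \<open>lam 1, \<dots>, lam M\<close> are the eigenvalues of \<open>A\<close>, listed with algebraic multiplicity.\<close>

definition eigenvalues_of :: "complex mat \<Rightarrow> nat \<Rightarrow> (nat \<Rightarrow> real) \<Rightarrow> bool" where
  "eigenvalues_of A M lam \<longleftrightarrow> char_poly A = (\<Prod>i=1..M. [:- complex_of_real (lam i), 1:])"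

text \<open>The interior of a simple closed curve is \<open>inside (path_image \<gamma>)\<close>; the winding number is
  \<open>1\<close> throughout the interior or \<open>-1\<close> throughout, so the last conjunct fixes the orientation.\<close>

definition pos_simple_contour :: "(real \<Rightarrow> complex) \<Rightarrow> bool" where
  "pos_simple_contour \<gamma> \<longleftrightarrow>
     valid_path \<gamma> \<and> simple_path \<gamma> \<and> pathfinish \<gamma> = pathstart \<gamma> \<and>
     (\<forall>z \<in> inside (path_image \<gamma>). winding_number \<gamma> z = 1)"

definition z_fun :: "nat \<Rightarrow> nat \<Rightarrow> (nat \<Rightarrow> real) \<Rightarrow> complex \<Rightarrow> complex" where
  "z_fun M L lam \<omega> =
     \<omega> * (1 - 1 / of_nat L * (\<Sum>i=1..M. of_real (lam i) / (of_real (lam i) - \<omega>)))"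

definition phi_fun :: "nat \<Rightarrow> nat \<Rightarrow> (nat \<Rightarrow> real) \<Rightarrow> (complex \<Rightarrow> complex) \<Rightarrow> complex \<Rightarrow> complex" where
  "phi_fun M L lam g \<omega> = g (z_fun M L lam \<omega>)"

definition psi_fun :: "nat \<Rightarrow> nat \<Rightarrow> (nat \<Rightarrow> real) \<Rightarrow> complex \<Rightarrow> complex" where
  "psi_fun M L lam \<omega> = deriv (z_fun M L lam) \<omega>"

lemma psi_fun_eq:
  assumes "\<And>i. i \<in> {1..M} \<Longrightarrow> \<omega> \<noteq> of_real (lam i)"
  shows "psi_fun M L lam \<omega> =
    1 - 1 / of_nat L * (\<Sum>i=1..M. (of_real (lam i))\<^sup>2 / (of_real (lam i) - \<omega>)\<^sup>2)"
proof -
  let ?l = "\<lambda>i. complex_of_real (lam i)"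
  have ne: "?l i - \<omega> \<noteq> 0" if "i \<in> {1..M}" for i
    using assms[OF that] by simp
  have d: "((\<lambda>w. ?l i / (?l i - w)) has_field_derivative ?l i / (?l i - \<omega>)\<^sup>2) (at \<omega>)"
    if "i \<in> {1..M}" for i
    using ne[OF that] by (auto intro!: derivative_eq_intros simp: power2_eq_square)
  have s: "((\<lambda>w. \<Sum>i=1..M. ?l i / (?l i - w)) has_field_derivative
      (\<Sum>i=1..M. ?l i / (?l i - \<omega>)\<^sup>2)) (at \<omega>)"
    by (rule DERIV_sum) (use d in auto)
  have t: "((\<lambda>w. w * (1 - 1 / of_nat L * (\<Sum>i=1..M. ?l i / (?l i - w)))) has_field_derivative
      1 * (1 - 1 / of_nat L * (\<Sum>i=1..M. ?l i / (?l i - \<omega>)))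
       + (0 - 1 / of_nat L * (\<Sum>i=1..M. ?l i / (?l i - \<omega>)\<^sup>2)) * \<omega>) (at \<omega>)"
    by (rule DERIV_mult' [THEN DERIV_cong] DERIV_mult DERIV_diff DERIV_const DERIV_ident
        DERIV_cmult s | simp)+
  have "?l i / (?l i - \<omega>) + \<omega> * (?l i / (?l i - \<omega>)\<^sup>2) = (?l i)\<^sup>2 / (?l i - \<omega>)\<^sup>2"
    if "i \<in> {1..M}" for i
    using ne[OF that] by (simp add: divide_simps power2_eq_square) (simp add: algebra_simps)
  then have e: "(\<Sum>i=1..M. ?l i / (?l i - \<omega>)) + \<omega> * (\<Sum>i=1..M. ?l i / (?l i - \<omega>)\<^sup>2) =
      (\<Sum>i=1..M. (?l i)\<^sup>2 / (?l i - \<omega>)\<^sup>2)"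
    unfolding sum_distrib_left sum.distrib[symmetric] by (intro sum.cong) auto
  have "psi_fun M L lam \<omega> = 1 * (1 - 1 / of_nat L * (\<Sum>i=1..M. ?l i / (?l i - \<omega>)))
       + (0 - 1 / of_nat L * (\<Sum>i=1..M. ?l i / (?l i - \<omega>)\<^sup>2)) * \<omega>"
    unfolding psi_fun_def z_fun_def by (rule DERIV_imp_deriv [OF t])
  also have "\<dots> = 1 - 1 / of_nat L * ((\<Sum>i=1..M. ?l i / (?l i - \<omega>))
       + \<omega> * (\<Sum>i=1..M. ?l i / (?l i - \<omega>)\<^sup>2))"
    by (simp add: algebra_simps add_divide_distrib)
  finally show ?thesis unfolding e .
qed

definition hd_statistic ::
  "nat \<Rightarrow> nat \<Rightarrow> (nat \<Rightarrow> real) \<Rightarrow> (complex \<Rightarrow> complex) \<Rightarrow> (real \<Rightarrow> complex) \<Rightarrow> complex" where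
  "hd_statistic M L lam g \<gamma> =
     (1 - of_nat L / of_nat M) *
       (1 / (2 * of_real pi * \<i>) * contour_integral \<gamma> (\<lambda>z. g z / z)) +
     of_nat L / of_nat M *
       (1 / (2 * of_real pi * \<i>) *
         contour_integral \<gamma> (\<lambda>\<omega>. phi_fun M L lam g \<omega> / \<omega> * psi_fun M L lam \<omega>))"

text \<open>The high-dimensional Frobenius norm test for an \<open>M \<times> M\<close> sample covariance matrix of \<open>L\<close> samples.\<close>

definition T_HDS :: "nat \<Rightarrow> nat \<Rightarrow> complex mat \<Rightarrow> complex" where
  "T_HDS M L R = 1 / of_nat M * mat_trace (R * R) + 1 / (of_nat L * of_nat M) * (mat_trace R)\<^sup>2"

end

theory Submission
  imports Defs
begin

text \<open>Write \<open>z_M(w) = w S(w)\<close> with \<open>S = 1 + T / L\<close> and \<open>T(w) = \<Sum>\<^sub>i \<lambda>\<^sub>i / (w - \<lambda>\<^sub>i)\<close>. For the square function the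
  second integrand \<open>w S\<^sup>2 (S + w S')\<close> equals \<open>(w\<^sup>2 S\<^sup>3 / 3)' + w S\<^sup>3 / 3\<close>, so only \<open>w S\<^sup>3\<close> has to be
  integrated. Expanding it in powers of \<open>T\<close>, products of two or more simple poles at points of equal
  winding number integrate to zero, and what remains is \<open>\<Sum>\<^sub>i \<lambda>\<^sub>i\<^sup>2 / L + (\<Sum>\<^sub>i \<lambda>\<^sub>i)\<^sup>2 / L\<^sup>2\<close>. The first
  integrand is entire. Power sums of the eigenvalues become traces by Schur triangularisation.\<close>

subsection \<open>Traces and eigenvalues\<close>

lemma mat_trace_mult_commute:
  fixes A B :: "'a :: comm_semiring_0 mat"
  assumes "A \<in> carrier_mat n m" and "B \<in> carrier_mat m n"
  shows "mat_trace (A * B) = mat_trace (B * A)"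
proof -
  have "mat_trace (A * B) = (\<Sum>i<n. \<Sum>k<m. A $$ (i, k) * B $$ (k, i))"
    using assms by (simp add: mat_trace_def scalar_prod_def atLeast0LessThan)
  also have "\<dots> = (\<Sum>k<m. \<Sum>i<n. B $$ (k, i) * A $$ (i, k))"
    by (subst sum.swap) (simp add: mult.commute)
  also have "\<dots> = mat_trace (B * A)"
    using assms by (simp add: mat_trace_def scalar_prod_def atLeast0LessThan)
  finally show ?thesis .
qed

lemma mat_trace_similar:
  fixes A B :: "'a :: comm_ring_1 mat"
  assumes "similar_mat A B"
  shows "mat_trace A = mat_trace B"
proof -
  obtain n P Q where *: "{A, B, P, Q} \<subseteq> carrier_mat n n" "Q * P = 1\<^sub>m n" "A = P * B * Q"
    using similar_matD[OF assms] by blast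
  then have "P * B \<in> carrier_mat n n"
    by auto
  then have "mat_trace A = mat_trace (Q * (P * B))"
    using * mat_trace_mult_commute[of "P * B" n n Q] by simp
  also have "Q * (P * B) = (Q * P) * B"
    using * by (intro assoc_mult_mat[symmetric]) auto
  also have "\<dots> = B"
    using * by auto
  finally show ?thesis .
qed

text \<open>For distinct \<open>i\<close> and \<open>k\<close>, one of the entries at
  \<open>(i, k)\<close> and \<open>(k, i)\<close> lies below the diagonal and vanishes, so their
  product contributes nothing to the trace.\<close>

lemma mat_trace_square_upper_triangular:
  fixes A :: "'a :: comm_semiring_1 mat"
  assumes "A \<in> carrier_mat n n" and "upper_triangular A"
  shows "mat_trace (A * A) = (\<Sum>i<n. (A $$ (i, i))\<^sup>2)"
proof -
  have *: "(\<Sum>k<n. A $$ (i, k) * A $$ (k, i)) = (A $$ (i, i))\<^sup>2" if "i < n" for i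
  proof -
    have "A $$ (i, k) * A $$ (k, i) = 0" if "k < n" "k \<noteq> i" for k
      using upper_triangularD[OF assms(2), of k i] upper_triangularD[OF assms(2), of i k]
        that \<open>i < n\<close> assms(1) by (cases "k < i") auto
    then have "(\<Sum>k<n. A $$ (i, k) * A $$ (k, i)) = (\<Sum>k\<in>{i}. A $$ (i, k) * A $$ (k, i))"
      using that by (intro sum.mono_neutral_right) auto
    then show ?thesis
      by (simp add: power2_eq_square)
  qed
  have "mat_trace (A * A) = (\<Sum>i<n. \<Sum>k<n. A $$ (i, k) * A $$ (k, i))"
    using assms(1) by (simp add: mat_trace_def scalar_prod_def atLeast0LessThan)
  with * show ?thesis
    by simp
qed

text \<open>Schur triangularisation makes \<open>A\<close> similar to an upper triangular
  \<open>B\<close> whose diagonal is the given list of eigenvalues. The same matrices conjugate the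
  squares, and both traces are then read off the diagonal of \<open>B\<close>.\<close>

lemma mat_trace_eigenvalues:
  fixes A :: "complex mat"
  assumes A: "A \<in> carrier_mat n n" and ev: "eigenvalues_of A m lam"
  shows "mat_trace A = (\<Sum>i=1..m. complex_of_real (lam i))"
    and "mat_trace (A * A) = (\<Sum>i=1..m. (complex_of_real (lam i))\<^sup>2)"
proof -
  define es where "es = map (\<lambda>i. complex_of_real (lam i)) [1..<Suc m]"
  have sum_es: "(\<Sum>e\<leftarrow>es. f e) = (\<Sum>i=1..m. f (complex_of_real (lam i)))" for f :: "complex \<Rightarrow> complex"
    by (simp add: es_def sum_list_distinct_conv_sum_set comp_def atLeastLessThanSuc_atLeastAtMost
        del: upt_Suc)
  have "char_poly A = (\<Prod>e\<leftarrow>es. [:- e, 1:])"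
    using ev by (simp add: eigenvalues_of_def es_def prod.distinct_set_conv_list[symmetric] comp_def
        atLeastLessThanSuc_atLeastAtMost del: upt_Suc)
  moreover obtain B P Q where "schur_decomposition A es = (B, P, Q)"
    by (cases "schur_decomposition A es")
  ultimately have sim: "similar_mat_wit A B P Q" and ut: "upper_triangular B"
    and diag: "diag_mat B = es"
    using schur_decomposition[OF A] by auto
  have B: "B \<in> carrier_mat n n"
    using similar_mat_witD2[OF A sim] by blast
  \<comment> \<open>The equality of lists \<open>diag_mat B = es\<close> carries a sum over the
    \<open>n\<close> diagonal entries to a sum over the \<open>m\<close> listed eigenvalues,
    multiplicities included.\<close>
  have sum_diag: "(\<Sum>i<n. f (B $$ (i, i))) = (\<Sum>i=1..m. f (complex_of_real (lam i)))"
    for f :: "complex \<Rightarrow> complex"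
  proof -
    have "(\<Sum>i<n. f (B $$ (i, i))) = (\<Sum>e\<leftarrow>diag_mat B. f e)"
      using B by (simp add: diag_mat_def sum_list_distinct_conv_sum_set comp_def atLeast0LessThan)
    then show ?thesis
      unfolding diag sum_es .
  qed
  have "mat_trace A = mat_trace B"
    using sim by (intro mat_trace_similar) (auto simp: similar_mat_def)
  then show "mat_trace A = (\<Sum>i=1..m. complex_of_real (lam i))"
    using B sum_diag[of "\<lambda>x. x"] by (simp add: mat_trace_def)
  have "similar_mat (A ^\<^sub>m 2) (B ^\<^sub>m 2)"
    using similar_mat_wit_pow[OF sim] by (auto simp: similar_mat_def)
  then have "mat_trace (A * A) = mat_trace (B * B)"
    using A B by (auto dest!: mat_trace_similar simp: numeral_2_eq_2)
  then show "mat_trace (A * A) = (\<Sum>i=1..m. (complex_of_real (lam i))\<^sup>2)"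
    using mat_trace_square_upper_triangular[OF B ut] sum_diag[of "\<lambda>x. x\<^sup>2"] by simp
qed

subsection \<open>Contour integrals of rational functions\<close>

text \<open>Distinct poles are separated by partial fractions, and the two equal winding numbers
  cancel; a genuine double pole has a primitive. Coincident points must be covered because
  eigenvalues may repeat and because a squared sum has diagonal terms.\<close>

lemma has_contour_integral_double_pole_zero:
  assumes "valid_path \<gamma>" "pathfinish \<gamma> = pathstart \<gamma>"
    and "a \<notin> path_image \<gamma>" "b \<notin> path_image \<gamma>" "winding_number \<gamma> a = winding_number \<gamma> b"
  shows "((\<lambda>w. 1 / ((w - a) * (w - b))) has_contour_integral 0) \<gamma>"
proof (cases "a = b")
  case True
  have "((\<lambda>w. - 1 / (w - a)) has_field_derivative 1 / ((w - a) * (w - b))) (at w within - {a})"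
    if "w \<in> - {a}" for w
    using that True by (auto intro!: derivative_eq_intros simp: field_simps)
  then show ?thesis
    by (rule Cauchy_theorem_primitive) (use assms in auto)
next
  case False
  have "((\<lambda>w. (1 / (w - a) - 1 / (w - b)) / (a - b)) has_contour_integral
      (2 * pi * \<i> * winding_number \<gamma> a - 2 * pi * \<i> * winding_number \<gamma> b) / (a - b)) \<gamma>"
    using assms by (intro has_contour_integral_div has_contour_integral_diff
        has_contour_integral_winding_number)
  then have "((\<lambda>w. (1 / (w - a) - 1 / (w - b)) / (a - b)) has_contour_integral 0) \<gamma>"
    using assms by simp
  then show ?thesis
    by (rule has_contour_integral_eq) (use assms False in \<open>auto simp: divide_simps\<close>)
qed

text \<open>If two of the points differ, partial fractions reduce the integrand to products of two
  poles; if all three agree, there is a primitive.\<close>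

lemma has_contour_integral_triple_pole_zero:
  assumes "valid_path \<gamma>" "pathfinish \<gamma> = pathstart \<gamma>"
    and nin: "a \<notin> path_image \<gamma>" "b \<notin> path_image \<gamma>" "c \<notin> path_image \<gamma>"
    and "winding_number \<gamma> a = winding_number \<gamma> b" "winding_number \<gamma> b = winding_number \<gamma> c"
  shows "((\<lambda>w. 1 / ((w - a) * (w - b) * (w - c))) has_contour_integral 0) \<gamma>"
proof -
  \<comment> \<open>The points are generalised because, when \<open>b\<close> and \<open>c\<close>
    differ, this fact is applied to the rotated triple \<open>b\<close>, \<open>c\<close>,
    \<open>a\<close>.\<close>
  have distinct: "((\<lambda>w. 1 / ((w - a) * (w - b) * (w - c))) has_contour_integral 0) \<gamma>"
    if "a \<noteq> b" "a \<notin> path_image \<gamma>" "b \<notin> path_image \<gamma>" "c \<notin> path_image \<gamma>"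
      "winding_number \<gamma> a = winding_number \<gamma> b" "winding_number \<gamma> b = winding_number \<gamma> c" for a b c
  proof -
    have "((\<lambda>w. (1 / ((w - a) * (w - c)) - 1 / ((w - b) * (w - c))) / (a - b))
        has_contour_integral (0 - 0) / (a - b)) \<gamma>"
      using assms(1,2) that
      by (intro has_contour_integral_div has_contour_integral_diff
          has_contour_integral_double_pole_zero) auto
    then have "((\<lambda>w. (1 / ((w - a) * (w - c)) - 1 / ((w - b) * (w - c))) / (a - b))
        has_contour_integral 0) \<gamma>"
      by simp
    then show ?thesis
      by (rule has_contour_integral_eq) (use that in \<open>auto simp: divide_simps\<close>)
  qed
  consider "a \<noteq> b" | "b \<noteq> c" | "a = b" "b = c"
    by blast
  then show ?thesis
  proof cases
    case 1
    then show ?thesis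
      using distinct assms by simp
  next
    case 2
    have "((\<lambda>w. 1 / ((w - b) * (w - c) * (w - a))) has_contour_integral 0) \<gamma>"
      by (rule distinct) (use assms 2 in auto)
    then show ?thesis
      by (simp add: mult_ac)
  next
    case 3
    have "((\<lambda>w. - 1 / (2 * (w - a)\<^sup>2)) has_field_derivative 1 / ((w - a) * (w - b) * (w - c)))
        (at w within - {a})"
      if "w \<in> - {a}" for w
      using that 3
      by (auto intro!: derivative_eq_intros simp: divide_simps power2_eq_square)
    then show ?thesis
      by (rule Cauchy_theorem_primitive) (use assms in auto)
  qed
qed

text \<open>After expanding the power of \<open>T\<close>, the factor \<open>w\<close> is absorbed
  into one pole of each summand by \<open>w / (w - l i) = 1 + l i / (w - l i)\<close>. Only terms
  with exactly one simple pole can then have a nonzero integral.\<close>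

lemma has_contour_integral_pole_sum_powers:
  fixes l :: "'i \<Rightarrow> complex"
  assumes \<gamma>: "valid_path \<gamma>" "pathfinish \<gamma> = pathstart \<gamma>" and "finite I"
    and nin: "\<And>i. i \<in> I \<Longrightarrow> l i \<notin> path_image \<gamma>"
    and wn: "\<And>i. i \<in> I \<Longrightarrow> winding_number \<gamma> (l i) = 1"
  defines "T \<equiv> \<lambda>w. \<Sum>i\<in>I. l i / (w - l i)"
  shows "((\<lambda>w. w * T w) has_contour_integral 2 * pi * \<i> * (\<Sum>i\<in>I. (l i)\<^sup>2)) \<gamma>"
    and "((\<lambda>w. w * (T w)\<^sup>2) has_contour_integral 2 * pi * \<i> * (\<Sum>i\<in>I. l i)\<^sup>2) \<gamma>"
    and "((\<lambda>w. w * (T w) ^ 3) has_contour_integral 0) \<gamma>"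
proof -
  have c0: "((\<lambda>w. c) has_contour_integral 0) \<gamma>" for c
  proof (rule Cauchy_theorem_primitive)
    show "((\<lambda>w. c * w) has_field_derivative c) (at w within UNIV)" for w
      by (auto intro!: derivative_eq_intros)
  qed (use \<gamma> in auto)
  have one: "((\<lambda>w. 1 / (w - l i)) has_contour_integral 2 * pi * \<i>) \<gamma>" if "i \<in> I" for i
    using has_contour_integral_winding_number[OF \<gamma>(1) nin[OF that]] wn[OF that] by simp
  have two: "((\<lambda>w. 1 / ((w - l i) * (w - l k))) has_contour_integral 0) \<gamma>"
    if "i \<in> I" "k \<in> I" for i k
    using that \<gamma> nin wn by (intro has_contour_integral_double_pole_zero) auto
  have three: "((\<lambda>w. 1 / ((w - l i) * (w - l j) * (w - l k))) has_contour_integral 0) \<gamma>"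
    if "i \<in> I" "j \<in> I" "k \<in> I" for i j k
    using that \<gamma> nin wn by (intro has_contour_integral_triple_pole_zero) auto
  have ne: "w - l i \<noteq> 0" if "w \<in> path_image \<gamma>" "i \<in> I" for w i
    using that nin by auto
  have split: "w / (w - l i) = 1 + l i / (w - l i)" if "w \<in> path_image \<gamma>" "i \<in> I" for w i
    using ne[OF that] by (simp add: field_simps)

  \<comment> \<open>Each summand is a constant plus a simple pole whose residue is the square of
    \<open>l i\<close>.\<close>
  have "((\<lambda>w. \<Sum>i\<in>I. l i + (l i)\<^sup>2 * (1 / (w - l i))) has_contour_integral
      (\<Sum>i\<in>I. 0 + (l i)\<^sup>2 * (2 * pi * \<i>))) \<gamma>"
    using \<open>finite I\<close> one c0
    by (intro has_contour_integral_sum has_contour_integral_add has_contour_integral_lmul)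
  then have "((\<lambda>w. w * T w) has_contour_integral (\<Sum>i\<in>I. 0 + (l i)\<^sup>2 * (2 * pi * \<i>))) \<gamma>"
  proof (rule has_contour_integral_eq)
    fix w assume "w \<in> path_image \<gamma>"
    then show "(\<Sum>i\<in>I. l i + (l i)\<^sup>2 * (1 / (w - l i))) = w * T w"
      unfolding T_def sum_distrib_left
      by (intro sum.cong refl) (use ne in \<open>simp add: field_simps power2_eq_square\<close>)
  qed
  then show "((\<lambda>w. w * T w) has_contour_integral 2 * pi * \<i> * (\<Sum>i\<in>I. (l i)\<^sup>2)) \<gamma>"
    by (simp add: sum_distrib_left mult_ac)

  \<comment> \<open>Absorbing \<open>w\<close> into the pole at \<open>l i\<close> leaves a single
    pole at \<open>l k\<close> with residue \<open>l i * l k\<close>; these residues add up to the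
    square of the sum.\<close>
  have "((\<lambda>w. \<Sum>i\<in>I. \<Sum>k\<in>I. l i * l k * (1 / (w - l k) + l i * (1 / ((w - l i) * (w - l k)))))
      has_contour_integral (\<Sum>i\<in>I. \<Sum>k\<in>I. l i * l k * (2 * pi * \<i> + l i * 0))) \<gamma>"
    using \<open>finite I\<close> one two
    by (intro has_contour_integral_sum has_contour_integral_add has_contour_integral_lmul)
  then have "((\<lambda>w. w * (T w)\<^sup>2) has_contour_integral
      (\<Sum>i\<in>I. \<Sum>k\<in>I. l i * l k * (2 * pi * \<i> + l i * 0))) \<gamma>"
  proof (rule has_contour_integral_eq)
    fix w assume w: "w \<in> path_image \<gamma>"
    have "w * (T w)\<^sup>2 = (\<Sum>i\<in>I. \<Sum>k\<in>I. w * (l i / (w - l i) * (l k / (w - l k))))"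
      unfolding T_def power2_eq_square sum_product by (simp add: sum_distrib_left)
    moreover have "w * (l i / (w - l i) * (l k / (w - l k)))
        = l i * l k * (1 / (w - l k) + l i * (1 / ((w - l i) * (w - l k))))"
      if "i \<in> I" "k \<in> I" for i k
    proof -
      have "w * (l i / (w - l i) * (l k / (w - l k))) = w / (w - l i) * (l i * l k * (1 / (w - l k)))"
        by simp
      also have "\<dots> = l i * l k * (1 / (w - l k) + l i * (1 / ((w - l i) * (w - l k))))"
        unfolding split[OF w that(1)] by (simp add: distrib_left distrib_right add_divide_distrib mult_ac)
      finally show ?thesis .
    qed
    ultimately show "(\<Sum>i\<in>I. \<Sum>k\<in>I. l i * l k *
        (1 / (w - l k) + l i * (1 / ((w - l i) * (w - l k))))) = w * (T w)\<^sup>2"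
      by simp
  qed
  then show "((\<lambda>w. w * (T w)\<^sup>2) has_contour_integral 2 * pi * \<i> * (\<Sum>i\<in>I. l i)\<^sup>2) \<gamma>"
    by (simp add: power2_eq_square sum_product sum_distrib_left mult_ac)

  \<comment> \<open>With three factors at least two poles remain after the absorption, so every term
    integrates to zero.\<close>
  have "((\<lambda>w. \<Sum>i\<in>I. \<Sum>j\<in>I. \<Sum>k\<in>I. l i * l j * l k *
        (1 / ((w - l j) * (w - l k)) + l i * (1 / ((w - l i) * (w - l j) * (w - l k)))))
      has_contour_integral (\<Sum>i\<in>I. \<Sum>j\<in>I. \<Sum>k\<in>I. l i * l j * l k * (0 + l i * 0))) \<gamma>"
    using \<open>finite I\<close> two three
    by (intro has_contour_integral_sum has_contour_integral_add has_contour_integral_lmul)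
  then have "((\<lambda>w. w * (T w) ^ 3) has_contour_integral
      (\<Sum>i\<in>I. \<Sum>j\<in>I. \<Sum>k\<in>I. l i * l j * l k * (0 + l i * 0))) \<gamma>"
  proof (rule has_contour_integral_eq)
    fix w assume w: "w \<in> path_image \<gamma>"
    have "w * (T w) ^ 3 = (\<Sum>i\<in>I. \<Sum>j\<in>I. \<Sum>k\<in>I.
        w * (l i / (w - l i) * (l j / (w - l j) * (l k / (w - l k)))))"
      unfolding T_def power3_eq_cube mult.assoc sum_distrib_right by (simp only: sum_distrib_left)
    moreover have "w * (l i / (w - l i) * (l j / (w - l j) * (l k / (w - l k)))) = l i * l j * l k *
        (1 / ((w - l j) * (w - l k)) + l i * (1 / ((w - l i) * (w - l j) * (w - l k))))"
      if "i \<in> I" "j \<in> I" "k \<in> I" for i j k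
    proof -
      have "w * (l i / (w - l i) * (l j / (w - l j) * (l k / (w - l k))))
          = w / (w - l i) * (l i * l j * l k * (1 / ((w - l j) * (w - l k))))"
        by simp
      also have "\<dots> = l i * l j * l k *
          (1 / ((w - l j) * (w - l k)) + l i * (1 / ((w - l i) * (w - l j) * (w - l k))))"
        unfolding split[OF w that(1)] by (simp add: distrib_left distrib_right add_divide_distrib mult_ac)
      finally show ?thesis .
    qed
    ultimately show "(\<Sum>i\<in>I. \<Sum>j\<in>I. \<Sum>k\<in>I. l i * l j * l k *
        (1 / ((w - l j) * (w - l k)) + l i * (1 / ((w - l i) * (w - l j) * (w - l k)))))
        = w * (T w) ^ 3"
      by simp
  qed
  then show "((\<lambda>w. w * (T w) ^ 3) has_contour_integral 0) \<gamma>"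
    by simp
qed

subsection \<open>The Frobenius norm statistic\<close>

lemma contour_integral_z_fun_square:
  assumes \<gamma>: "valid_path \<gamma>" "pathfinish \<gamma> = pathstart \<gamma>"
    and nin: "\<And>i. i \<in> {1..M} \<Longrightarrow> complex_of_real (lam i) \<notin> path_image \<gamma>"
    and wn: "\<And>i. i \<in> {1..M} \<Longrightarrow> winding_number \<gamma> (complex_of_real (lam i)) = 1"
  shows "contour_integral \<gamma> (\<lambda>w. phi_fun M L lam (\<lambda>z. z\<^sup>2) w / w * psi_fun M L lam w) =
    2 * pi * \<i> * ((\<Sum>i=1..M. (complex_of_real (lam i))\<^sup>2) / of_nat L
      + (\<Sum>i=1..M. complex_of_real (lam i))\<^sup>2 / (of_nat L)\<^sup>2)"
proof -
  let ?l = "\<lambda>i. complex_of_real (lam i)"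
  define c :: complex where "c = 1 / of_nat L"
  define T where "T w = (\<Sum>i=1..M. ?l i / (w - ?l i))" for w
  define T' where "T' = (\<lambda>w. \<Sum>i=1..M. - ?l i / (w - ?l i)\<^sup>2)"
  define S where "S = (\<lambda>w. 1 + c * T w)"
  define s1 s2 where "s1 = (\<Sum>i=1..M. ?l i)" and "s2 = (\<Sum>i=1..M. (?l i)\<^sup>2)"
  \<comment> \<open>The equality holds at every point, also at the eigenvalues, where division by
    zero gives 0 on both sides. As an equality of functions it can be rewritten under
    \<open>deriv\<close>.\<close>
  have z: "z_fun M L lam = (\<lambda>w. w * S w)"
  proof
    fix w
    have "?l i / (?l i - w) = - (?l i / (w - ?l i))" for i
      by (metis minus_diff_eq divide_minus_right)
    then show "z_fun M L lam w = w * S w"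
      by (simp add: z_fun_def S_def T_def c_def sum_negf)
  qed
  have dS: "(S has_field_derivative c * T' w) (at w)" if "w \<in> - ?l ` {1..M}" for w
  proof -
    have "((\<lambda>w. ?l i / (w - ?l i)) has_field_derivative - ?l i / (w - ?l i)\<^sup>2) (at w)"
      if "i \<in> {1..M}" for i
      using that \<open>w \<in> - ?l ` {1..M}\<close>
      by (auto intro!: derivative_eq_intros simp: power2_eq_square)
    then have "(T has_field_derivative T' w) (at w)"
      unfolding T_def[abs_def] T'_def by (rule DERIV_sum)
    then show ?thesis
      unfolding S_def by (auto intro!: derivative_eq_intros)
  qed
  have psi: "psi_fun M L lam w = S w + w * (c * T' w)" if "w \<in> - ?l ` {1..M}" for w
    unfolding psi_fun_def z
    by (rule DERIV_imp_deriv) (use dS[OF that] in \<open>auto intro!: derivative_eq_intros\<close>)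
  have im: "path_image \<gamma> \<subseteq> - ?l ` {1..M}"
    using nin by auto

  \<comment> \<open>This is the derivative of \<open>w\<^sup>2 * S w ^ 3 / 3\<close>, chosen so that
    its second term reproduces the part of the integrand that contains the derivative of
    \<open>S\<close>.\<close>
  define F' where "F' = (\<lambda>w. (2 * w * S w ^ 3 + w\<^sup>2 * (3 * S w ^ 2 * (c * T' w))) / 3)"
  have "((\<lambda>w. w\<^sup>2 * S w ^ 3 / 3) has_field_derivative F' w) (at w within - ?l ` {1..M})"
    if "w \<in> - ?l ` {1..M}" for w
    unfolding F'_def
    by (rule has_field_derivative_at_within)
      (use dS[OF that] in \<open>auto intro!: derivative_eq_intros simp: power2_eq_square algebra_simps\<close>)
  then have exact: "(F' has_contour_integral 0) \<gamma>"
    by (rule Cauchy_theorem_primitive) (use \<gamma> im in auto)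

  note T_powers = has_contour_integral_pole_sum_powers[of \<gamma> "{1..M}" ?l, OF \<gamma> finite_atLeastAtMost nin wn,
      folded T_def s1_def s2_def]
  have "((\<lambda>w. w) has_contour_integral 0) \<gamma>"
  proof (rule Cauchy_theorem_primitive)
    show "((\<lambda>w. w\<^sup>2 / 2) has_field_derivative w) (at w within UNIV)" for w :: complex
      by (auto intro!: derivative_eq_intros)
  qed (use \<gamma> in auto)
  \<comment> \<open>The coefficients 1/3, \<open>c\<close>, \<open>c\<^sup>2\<close> and
    \<open>c ^ 3 / 3\<close> come from expanding one third of
    \<open>(1 + c * T w) ^ 3\<close>.\<close>
  then have "((\<lambda>w. F' w + w / 3 + c * (w * T w) + c\<^sup>2 * (w * (T w)\<^sup>2) + c ^ 3 / 3 * (w * T w ^ 3))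
      has_contour_integral 0 + 0 / 3 + c * (2 * pi * \<i> * s2) + c\<^sup>2 * (2 * pi * \<i> * s1\<^sup>2) + c ^ 3 / 3 * 0) \<gamma>"
    using T_powers exact
    by (intro has_contour_integral_add has_contour_integral_lmul has_contour_integral_div)
  then have "((\<lambda>w. phi_fun M L lam (\<lambda>z. z\<^sup>2) w / w * psi_fun M L lam w) has_contour_integral
      0 + 0 / 3 + c * (2 * pi * \<i> * s2) + c\<^sup>2 * (2 * pi * \<i> * s1\<^sup>2) + c ^ 3 / 3 * 0) \<gamma>"
  proof (rule has_contour_integral_eq)
    fix w assume "w \<in> path_image \<gamma>"
    then have "w \<in> - ?l ` {1..M}"
      using im by blast
    \<comment> \<open>The cancellation of \<open>w\<close> is valid also at \<open>w = 0\<close>,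
      where both sides are 0 by the convention for division by zero, so the contour may pass through
      the origin.\<close>
    then have "phi_fun M L lam (\<lambda>z. z\<^sup>2) w / w * psi_fun M L lam w
        = w * (S w)\<^sup>2 * (S w + w * (c * T' w))"
      by (simp add: phi_fun_def z psi power2_eq_square)
    also have "\<dots> = F' w + w * S w ^ 3 / 3"
      by (simp add: F'_def field_simps power2_eq_square power3_eq_cube)
    also have "w * S w ^ 3 / 3 = w / 3 + c * (w * T w) + c\<^sup>2 * (w * (T w)\<^sup>2) + c ^ 3 / 3 * (w * T w ^ 3)"
      by (simp add: S_def field_simps power2_eq_square power3_eq_cube)
    finally show "F' w + w / 3 + c * (w * T w) + c\<^sup>2 * (w * (T w)\<^sup>2) + c ^ 3 / 3 * (w * T w ^ 3)
        = phi_fun M L lam (\<lambda>z. z\<^sup>2) w / w * psi_fun M L lam w"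
      by simp
  qed
  then show ?thesis
    by (simp add: contour_integral_unique c_def s1_def s2_def field_simps power2_eq_square)
qed

text \<open>Separates the diagonal from the off-diagonal products, which turns the squared trace
  into the sum over pairs in the last form of the statistic.\<close>

lemma sum_square_eq_sum_squares_pairs:
  fixes x :: "nat \<Rightarrow> 'a :: comm_ring_1"
  shows "(\<Sum>i=1..n. x i)\<^sup>2 =
    (\<Sum>i=1..n. (x i)\<^sup>2) + 2 * (\<Sum>(i, k)\<in>{(i, k). 1 \<le> i \<and> i < k \<and> k \<le> n}. x i * x k)"
proof (induction n)
  case 0
  have no_pairs: "{(i, k). 1 \<le> i \<and> i < k \<and> k \<le> (0::nat)} = {}"
    by auto
  show ?case
    unfolding no_pairs by simp
next
  case (Suc n)
  let ?P = "\<lambda>n. {(i, k). 1 \<le> i \<and> i < k \<and> k \<le> (n::nat)}"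
  have "finite (?P n)"
    by (rule finite_subset[of _ "{..n} \<times> {..n}"]) auto
  \<comment> \<open>Raising the bound to \<open>Suc n\<close> adds exactly the pairs whose larger
    index is \<open>Suc n\<close>.\<close>
  then have "(\<Sum>(i, k)\<in>?P n \<union> {1..n} \<times> {Suc n}. x i * x k) =
      (\<Sum>(i, k)\<in>?P n. x i * x k) + (\<Sum>(i, k)\<in>{1..n} \<times> {Suc n}. x i * x k)"
    by (intro sum.union_disjoint) auto
  also have "?P n \<union> {1..n} \<times> {Suc n} = ?P (Suc n)"
    by auto
  finally have "(\<Sum>(i, k)\<in>?P (Suc n). x i * x k) =
      (\<Sum>(i, k)\<in>?P n. x i * x k) + (\<Sum>(i, k)\<in>{1..n} \<times> {Suc n}. x i * x k)"
    .
  also have "(\<Sum>(i, k)\<in>{1..n} \<times> {Suc n}. x i * x k) = (\<Sum>i=1..n. x i) * x (Suc n)"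
    by (simp add: sum.cartesian_product[symmetric] sum_distrib_right)
  finally show ?case
    using Suc.IH by (simp add: power2_sum algebra_simps)
qed

theorem theorem4:
  fixes M L :: nat and Y R :: "complex mat" and lam :: "nat \<Rightarrow> real"
    and a b :: real and \<gamma> :: "real \<Rightarrow> complex"
  assumes "M \<ge> 1" and "L \<ge> 1"
    and "Y \<in> carrier_mat M L"
    and "R = sample_covariance Y"
    and "eigenvalues_of R M lam"
    and "0 < a" and "\<And>i. i \<in> {1..M} \<Longrightarrow> lam i \<in> {a..b}"
    and "pos_simple_contour \<gamma>"
    and "\<And>i. i \<in> {1..M} \<Longrightarrow> complex_of_real (lam i) \<in> inside (path_image \<gamma>)"
  shows "hd_statistic M L lam (\<lambda>z. z\<^sup>2) \<gamma> = T_HDS M L R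
    \<and> T_HDS M L R = 1 / of_nat M * mat_trace (R * R) + 1 / (of_nat L * of_nat M) * (mat_trace R)\<^sup>2
    \<and> T_HDS M L R = complex_of_real
        (1 / real M * (\<Sum>i=1..M. (lam i)\<^sup>2) + 1 / (real L * real M) * (\<Sum>i=1..M. lam i)\<^sup>2)
    \<and> T_HDS M L R = complex_of_real
        (1 / real M * (1 + 1 / real L) * (\<Sum>i=1..M. (lam i)\<^sup>2)
         + 2 / (real L * real M) * (\<Sum>(i, k)\<in>{(i, k). 1 \<le> i \<and> i < k \<and> k \<le> M}. lam i * lam k))"
proof -
  let ?l = "\<lambda>i. complex_of_real (lam i)"
  have R: "R \<in> carrier_mat M M"
    using assms(3,4) by (auto simp: sample_covariance_def mat_adjoint_def)
  note traces = mat_trace_eigenvalues[OF R assms(5)]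
  have wn: "winding_number \<gamma> (?l i) = 1" if "i \<in> {1..M}" for i
    using assms(8,9) that by (auto simp: pos_simple_contour_def)
  have nin: "?l i \<notin> path_image \<gamma>" if "i \<in> {1..M}" for i
    using assms(9)[OF that] inside_no_overlap by blast
  have \<gamma>: "valid_path \<gamma>" "pathfinish \<gamma> = pathstart \<gamma>"
    using assms(8) by (auto simp: pos_simple_contour_def)
  \<comment> \<open>Since 0/0 is 0, the integrand agrees with the identity function on the whole
    plane, so the position of the origin relative to the contour does not matter.\<close>
  have "((\<lambda>z. z\<^sup>2 / z) has_contour_integral 0) \<gamma>"
  proof (rule Cauchy_theorem_primitive)
    show "((\<lambda>z. z\<^sup>2 / 2) has_field_derivative z\<^sup>2 / z) (at z within UNIV)" for z :: complex
      by (auto intro!: derivative_eq_intros simp: power2_eq_square)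
  qed (use \<gamma> in auto)
  then have "contour_integral \<gamma> (\<lambda>z. z\<^sup>2 / z) = 0"
    by (rule contour_integral_unique)
  moreover have "contour_integral \<gamma> (\<lambda>w. phi_fun M L lam (\<lambda>z. z\<^sup>2) w / w * psi_fun M L lam w) =
      2 * pi * \<i> * ((\<Sum>i=1..M. (?l i)\<^sup>2) / of_nat L + (\<Sum>i=1..M. ?l i)\<^sup>2 / (of_nat L)\<^sup>2)"
    using \<gamma> nin wn by (rule contour_integral_z_fun_square)
  \<comment> \<open>The term with weight \<open>1 - L / M\<close> vanishes, and
    \<open>2 * pi * \<i>\<close> cancels against the normalisation of the second integral.\<close>
  ultimately have "hd_statistic M L lam (\<lambda>z. z\<^sup>2) \<gamma> = of_nat L / of_nat M *
      ((\<Sum>i=1..M. (?l i)\<^sup>2) / of_nat L + (\<Sum>i=1..M. ?l i)\<^sup>2 / (of_nat L)\<^sup>2)"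
    by (simp only: hd_statistic_def) simp
  also have "\<dots> = T_HDS M L R"
    using assms(1,2) by (simp add: T_HDS_def traces field_simps power2_eq_square)
  finally have eq1: "hd_statistic M L lam (\<lambda>z. z\<^sup>2) \<gamma> = T_HDS M L R" .
  have eq2: "T_HDS M L R = complex_of_real
      (1 / real M * (\<Sum>i=1..M. (lam i)\<^sup>2) + 1 / (real L * real M) * (\<Sum>i=1..M. lam i)\<^sup>2)"
    by (simp add: T_HDS_def traces)
  \<comment> \<open>The diagonal part of the squared sum joins the first term, which explains the
    factor \<open>1 + 1 / real L\<close>.\<close>
  have eq3: "1 / real M * (\<Sum>i=1..M. (lam i)\<^sup>2) + 1 / (real L * real M) * (\<Sum>i=1..M. lam i)\<^sup>2 =
      1 / real M * (1 + 1 / real L) * (\<Sum>i=1..M. (lam i)\<^sup>2)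
         + 2 / (real L * real M) * (\<Sum>(i, k)\<in>{(i, k). 1 \<le> i \<and> i < k \<and> k \<le> M}. lam i * lam k)"
    unfolding sum_square_eq_sum_squares_pairs by (simp only: ring_distribs) simp
  show ?thesis
    by (intro conjI eq1 eq2 eq2[unfolded eq3] T_HDS_def)
qed

end
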